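(* Let $\hat H>0$, $\hat G>0$ and $\epsilon>0$ be arbitrary. There exists a problem $(\mathcal{Y},h,g)$ with exactly three labels, with $\max_{y\in\mathcal{Y}}h(y)=\hat H$ and $\max_{y\in\mathcal{Y}}g(y)=\hat G$, such that for every $\lambda\ge 0$ the label $\mathcal{O}(\lambda)$ returned by the $\lambda$-oracle satisfies $$\Phi(\mathcal{O}(\lambda))=\min_{y\in\mathcal{Y}}\Phi(y)<\epsilon ,$$ while $\Phi(y^* )=\tfrac14\hat H\hat G$, where $y^*\in\arg\max_{y\in\mathcal{Y}}\Phi(y)$.
   Context: A problem $(\mathcal{Y},h,g)$ consists of a finite set of labels $\mathcal{Y}$ and two functions $h:\mathcal{Y}\to\mathbb{R}$ and $g:\mathcal{Y}\to[0,\infty)$. The (slack rescaling) objective is $\Phi(y)=h(y)g(y)$. For $\lambda\ge0$ the $\lambda$-oracle returns a maximizer $\mathcal{O}(\lambda)\in\arg\max_{y\in\mathcal{Y}}\,(h(y)+\lambda g(y))$; ties may be broken arbitrarily. *)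

theory Defs imports Complex_Main begin

definition slack_problem :: "'a set \<Rightarrow> ('a \<Rightarrow> real) \<Rightarrow> ('a \<Rightarrow> real) \<Rightarrow> bool" where
  "slack_problem Y h g \<longleftrightarrow> finite Y \<and> (\<forall>y\<in>Y. 0 \<le> g y)"

definition slack_objective :: "('a \<Rightarrow> real) \<Rightarrow> ('a \<Rightarrow> real) \<Rightarrow> 'a \<Rightarrow> real" where
  "slack_objective h g y = h y * g y"

text \<open>An oracle is any selection of maximizers. Quantifying over all such selections
  accounts for arbitrary tie-breaking. Values at negative parameters are unconstrained.\<close>

definition lambda_oracle ::
    "'a set \<Rightarrow> ('a \<Rightarrow> real) \<Rightarrow> ('a \<Rightarrow> real) \<Rightarrow> (real \<Rightarrow> 'a) \<Rightarrow> bool" where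
  "lambda_oracle Y h g orc \<longleftrightarrow>
     (\<forall>l\<ge>0. is_arg_max (\<lambda>y. h y + l * g y) (\<lambda>y. y \<in> Y) (orc l))"

end

(* The labels are (h,g) = (H, tG), (tH, G) and (H/2, G/2) with t small. The last is the midpoint of
   (H,0) and (0,G), hence lies strictly below the segment joining the first two labels, so no
   linear functional h + l*g selects it; yet it has the largest product. *)
theory Submission imports Defs begin

theorem theorem1:
  fixes H G \<epsilon> :: real
  assumes "H > 0" and "G > 0" and "\<epsilon> > 0"
  shows "\<exists>(Y :: nat set) (h :: nat \<Rightarrow> real) (g :: nat \<Rightarrow> real).
    slack_problem Y h g \<and> card Y = 3 \<and>
    Max (h ` Y) = H \<and> Max (g ` Y) = G \<and>
    (\<forall>orc. lambda_oracle Y h g orc \<longrightarrow>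
       (\<forall>l\<ge>0. slack_objective h g (orc l) = Min (slack_objective h g ` Y) \<and>
               Min (slack_objective h g ` Y) < \<epsilon>)) \<and>
    (\<forall>ystar. is_arg_max (slack_objective h g) (\<lambda>y. y \<in> Y) ystar \<longrightarrow>
       slack_objective h g ystar = 1 / 4 * H * G)"
proof -
  have HG: "H * G > 0" using assms by simp
  \<comment> \<open>The bound 1/8, being below 1/4, makes the common product
    \<open>t * (H * G)\<close> of labels 0 and 1 strictly smaller than that of label 2; the factor 2
    in the other bound makes it strictly smaller than \<open>\<epsilon>\<close>.\<close>
  define t where "t = min (1/8) (\<epsilon> / (2 * (H * G)))"
  have t: "t > 0" "t \<le> 1/8" using assms HG by (auto simp: t_def)
  have "t * (H * G) \<le> \<epsilon> / (2 * (H * G)) * (H * G)"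
    using HG by (intro mult_right_mono) (auto simp: t_def)
  also have "\<dots> < \<epsilon>" using assms by simp
  finally have small: "t * (H * G) < \<epsilon>" .
  have below: "t * (H * G) < H * G / 4" 
    using mult_right_mono[OF t(2), of "H * G"] HG by simp
  \<comment> \<open>These bounds let labels 0 and 1 attain the maxima of \<open>h\<close> and
    \<open>g\<close> respectively.\<close>
  have tH: "t * H \<le> H" and tG: "t * G \<le> G"
    using t assms by (auto simp: mult_le_cancel_right1)
  define Y :: "nat set" where "Y = {0, 1, 2}"
  define h :: "nat \<Rightarrow> real" where "h y = (if y = 0 then H else if y = 1 then t * H else H / 2)" for y
  define g :: "nat \<Rightarrow> real" where "g y = (if y = 0 then t * G else if y = 1 then G else G / 2)" for y
  have \<Phi>: "slack_objective h g 0 = t * (H * G)" "slack_objective h g 1 = t * (H * G)"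
    "slack_objective h g 2 = H * G / 4"
    by (simp_all add: slack_objective_def h_def g_def)
  have Min: "Min (slack_objective h g ` Y) = t * (H * G)"
    using below \<Phi> by (simp add: Y_def)
  have orc: "slack_objective h g (orc l) = t * (H * G)"
    if "lambda_oracle Y h g orc" "l \<ge> 0" for orc l
  proof -
    have max: "orc l \<in> Y" "\<And>y. y \<in> Y \<Longrightarrow> h y + l * g y \<le> h (orc l) + l * g (orc l)"
      using that by (auto simp: lambda_oracle_def is_arg_max_def not_less)
    \<comment> \<open>Excluding label 2 settles every tie-breaking rule, since labels 0 and 1 have
      equal objective values.\<close>
    have "orc l \<noteq> 2"
    proof
      assume "orc l = 2"
      then have "H + l * (t * G) \<le> H / 2 + l * (G / 2)" "t * H + l * G \<le> H / 2 + l * (G / 2)"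
        using max(2)[of 0] max(2)[of 1] by (simp_all add: Y_def h_def g_def)
      \<comment> \<open>Adding the two inequalities cancels \<open>H\<close> and
        \<open>l * G\<close>, because label 2 has exactly half of each; only the perturbation by
        \<open>t\<close> survives. Its part \<open>t * H\<close> is positive even at
        \<open>l = 0\<close>.\<close>
      then have "t * H + l * (t * G) \<le> 0" by simp
      moreover have "t * H > 0" "l * (t * G) \<ge> 0" using t assms that by simp_all
      ultimately show False by simp
    qed
    with max(1) show ?thesis using \<Phi> by (auto simp: Y_def)
  qed
  have star: "slack_objective h g y = 1 / 4 * H * G"
    if "is_arg_max (slack_objective h g) (\<lambda>y. y \<in> Y) y" for y
  proof -
    \<comment> \<open>Comparison with label 2 alone forces \<open>y = 2\<close>, as by
      \<open>below\<close> the other labels have strictly smaller products.\<close>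
    have "y \<in> Y" "slack_objective h g 2 \<le> slack_objective h g y"
      using that by (auto simp: is_arg_max_def not_less Y_def)
    then show ?thesis using \<Phi> below by (auto simp: Y_def)
  qed
  have "slack_problem Y h g" "card Y = 3" "Max (h ` Y) = H" "Max (g ` Y) = G"
    using assms t tH tG by (auto simp: slack_problem_def Y_def h_def g_def)
  with orc star Min small show ?thesis by metis
qed

end
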